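(* Let $X$ be a real locally convex Hausdorff topological vector space, $T$ a nonempty index set, $a_t\in X^*$ and $b_t\in\mathbb R$ for $t\in T$, and assume $\{x\in X:\langle a_t,x\rangle\le b_t\ \forall t\in T\}\ne\emptyset$. For $c\in X^*$ consider $$({\rm LIP}_c)\quad\inf\{\langle c,x\rangle:\ x\in X,\ \langle a_t,x\rangle\le b_t\ \forall t\in T\},$$ $$({\rm LID}^1_c)\quad\sup\{-\lambda b_t:\ t\in T,\ \lambda\ge0,\ c=-\lambda a_t\},$$ $$({\rm LID}^2_c)\quad\sup\Big\{-\sum_{t\in\operatorname{supp}\lambda}\lambda_tb_t:\ \lambda\in\mathbb R_+^{(T)},\ c=-\sum_{t\in\operatorname{supp}\lambda}\lambda_ta_t\Big\},$$ $$({\rm LID}^3_c)\quad\sup_{\lambda\ge0}\ \inf_{x\in X}\ \sup_{t\in T}\big[\langle c,x\rangle+\langle\lambda a_t,x\rangle-\lambda b_t\big],$$ and the sets $$\mathcal E_1:=\bigcup_{t\in T}\operatorname{co}\operatorname{cone}\{(a_t,b_t),(0_{X^*},1)\},\qquad \mathcal E_2:=\operatorname{co}\operatorname{cone}\big(\{(a_t,b_t):t\in T\}\cup\{(0_{X^*},1)\}\big),$$ $$\mathcal E_3:=\operatorname{cone}\overline{\operatorname{co}}\big(\{(a_t,b_t):t\in T\}\cup\{(0_{X^*},1)\}\big).$$ Then: (i) $\mathcal E_1$ is a closed and convex subset of $X^*\times\mathbb R$ if and only if stable strong duality holds for $({\rm LIP}_c)-({\rm LID}^1_c)$, i.e. $\inf({\rm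 LIP}_c)=\max({\rm LID}^1_c)$ for all $c\in X^*$. (ii) For each $i\in\{2,3\}$, $\mathcal E_i$ is a closed subset of $X^*\times\mathbb R$ if and only if $\inf({\rm LIP}_c)=\max({\rm LID}^i_c)$ for all $c\in X^*$.
   Context: $X^*$ is the topological dual of $X$ with the weak* topology; $X^*\times\mathbb R$ has the product topology. $\mathbb R_+^{(T)}$ is the set of families $(\lambda_t)_{t\in T}$ of nonnegative reals with finite support $\operatorname{supp}\lambda$; empty sums are zero, $\sup\emptyset=-\infty$. $\operatorname{cone}B=\{\lambda b:\lambda\ge0,b\in B\}$, $\operatorname{co}$ is the convex hull and $\overline{\operatorname{co}}$ the closed convex hull. "$\inf=\max$" means that the two optimal values are equal and that, when this common value is finite, the supremum in the dual problem is attained (in $({\rm LID}^3_c)$: the supremum over $\lambda\ge0$). *)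

theory Defs
  imports "HOL-Analysis.Analysis"
begin

section \<open>Locally convex Hausdorff spaces\<close>

text \<open>The last axiom spells out \<^const>\<open>convex\<close>, which cannot be used inside a class specification.\<close>

class lc_hausdorff_tvs = real_vector + topological_ab_group_add + t2_space +
  assumes tendsto_scaleR_Pair:
      "LIM p (nhds r \<times>\<^sub>F nhds x). fst p *\<^sub>R snd p :> nhds (r *\<^sub>R x)"
    and locally_convex_0:
      "open U \<Longrightarrow> 0 \<in> U \<Longrightarrow> \<exists>V. open V \<and> 0 \<in> V \<and> V \<subseteq> U \<and>
        (\<forall>x\<in>V. \<forall>y\<in>V. \<forall>u\<ge>0. \<forall>v\<ge>0. u + v = 1 \<longrightarrow> u *\<^sub>R x + v *\<^sub>R y \<in> V)"

lemma locally_convex: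
  fixes U :: "'a::lc_hausdorff_tvs set"
  assumes "open U" "0 \<in> U"
  shows "\<exists>V. open V \<and> convex V \<and> 0 \<in> V \<and> V \<subseteq> U"
  using locally_convex_0[OF assms] unfolding convex_def by blast

instance real_normed_vector \<subseteq> lc_hausdorff_tvs
proof
  fix r :: real and x :: 'a
  show "LIM p (nhds r \<times>\<^sub>F nhds x). fst p *\<^sub>R snd p :> nhds (r *\<^sub>R x)"
    by (intro tendsto_scaleR filterlim_fst filterlim_snd)
next
  fix U :: "'a set"
  assume "open U" "0 \<in> U"
  then obtain e where "e > 0" "ball 0 e \<subseteq> U"
    using openE by blast
  then show "\<exists>V. open V \<and> 0 \<in> V \<and> V \<subseteq> U \<and>
        (\<forall>x\<in>V. \<forall>y\<in>V. \<forall>u\<ge>0. \<forall>v\<ge>0. u + v = 1 \<longrightarrow> u *\<^sub>R x + v *\<^sub>R y \<in> V)"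
    using convex_ball[of "0::'a" e] unfolding convex_def
    by (intro exI[of _ "ball 0 e"] conjI) auto
qed

section \<open>The topological dual with the weak* topology\<close>

typedef (overloaded) 'a dual =
    "{f :: 'a::lc_hausdorff_tvs \<Rightarrow> real. linear f \<and> continuous_on UNIV f}"
  morphisms dual_apply Dual
proof
  show "(\<lambda>x. 0) \<in> {f :: 'a \<Rightarrow> real. linear f \<and> continuous_on UNIV f}"
    by (simp add: linear_iff)
qed

setup_lifting type_definition_dual

instantiation dual :: (lc_hausdorff_tvs) real_vector
begin

lift_definition zero_dual :: "'a dual" is "\<lambda>x. 0"
  by (simp add: linear_iff)

lift_definition plus_dual :: "'a dual \<Rightarrow> 'a dual \<Rightarrow> 'a dual" is "\<lambda>f g x. f x + g x"
  by (simp add: linear_compose_add continuous_on_add)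

lift_definition minus_dual :: "'a dual \<Rightarrow> 'a dual \<Rightarrow> 'a dual" is "\<lambda>f g x. f x - g x"
  by (simp add: linear_compose_sub continuous_on_diff)

lift_definition uminus_dual :: "'a dual \<Rightarrow> 'a dual" is "\<lambda>f x. - f x"
  by (simp add: linear_compose_neg continuous_on_minus)

lift_definition scaleR_dual :: "real \<Rightarrow> 'a dual \<Rightarrow> 'a dual" is "\<lambda>r f x. r * f x"
  by (auto simp: linear_iff algebra_simps intro!: continuous_intros)

instance
  by standard (transfer; simp add: fun_eq_iff algebra_simps)+

end

text \<open>The weak* topology is the topology of pointwise convergence, that is, the coarsest one
  making \<^term>\<open>dual_apply\<close> continuous into the product topology on functions.\<close>

instantiation dual :: (lc_hausdorff_tvs) topological_space
begin

definition open_dual :: "'a dual set \<Rightarrow> bool" where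
  "open_dual U \<longleftrightarrow> (\<exists>W :: ('a \<Rightarrow> real) set. open W \<and> U = dual_apply -` W)"

instance
proof
  show "open (UNIV :: 'a dual set)"
    unfolding open_dual_def by (intro exI[of _ UNIV]) simp
next
  fix S T :: "'a dual set"
  assume "open S" "open T"
  then show "open (S \<inter> T)"
    unfolding open_dual_def by (metis open_Int vimage_Int)
next
  fix K :: "'a dual set set"
  assume "\<forall>S\<in>K. open S"
  then obtain W :: "'a dual set \<Rightarrow> ('a \<Rightarrow> real) set"
    where W: "\<forall>S\<in>K. open (W S) \<and> S = dual_apply -` W S"
    unfolding open_dual_def by metis
  then have "open (\<Union>S\<in>K. W S)" "\<Union>K = dual_apply -` (\<Union>S\<in>K. W S)"
    by auto
  then show "open (\<Union>K)"
    unfolding open_dual_def by blast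
qed

end

section \<open>The linear infinite problem and its duals\<close>

definition feasible :: "'i set \<Rightarrow> ('i \<Rightarrow> 'a::lc_hausdorff_tvs dual) \<Rightarrow> ('i \<Rightarrow> real) \<Rightarrow> 'a set" where
  "feasible T a b = {x. \<forall>t\<in>T. dual_apply (a t) x \<le> b t}"

definition inf_LIP ::
    "'i set \<Rightarrow> ('i \<Rightarrow> 'a::lc_hausdorff_tvs dual) \<Rightarrow> ('i \<Rightarrow> real) \<Rightarrow> 'a dual \<Rightarrow> ereal" where
  "inf_LIP T a b c = (INF x\<in>feasible T a b. ereal (dual_apply c x))"

text \<open>\<open>inf_eq_max p D g\<close>: the value \<open>p\<close> equals the supremum of \<open>g\<close> over the feasible set \<open>D\<close>,
  and this supremum is attained whenever it is finite.\<close>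

definition inf_eq_max :: "ereal \<Rightarrow> 'd set \<Rightarrow> ('d \<Rightarrow> ereal) \<Rightarrow> bool" where
  "inf_eq_max p D g \<longleftrightarrow> p = (SUP d\<in>D. g d) \<and> (\<bar>p\<bar> \<noteq> \<infinity> \<longrightarrow> (\<exists>d\<in>D. g d = (SUP d\<in>D. g d)))"

definition LID1_feasible ::
    "'i set \<Rightarrow> ('i \<Rightarrow> 'a::lc_hausdorff_tvs dual) \<Rightarrow> 'a dual \<Rightarrow> ('i \<times> real) set" where
  "LID1_feasible T a c = {(t, l). t \<in> T \<and> 0 \<le> l \<and> c = - (l *\<^sub>R a t)}"

definition LID1_obj :: "('i \<Rightarrow> real) \<Rightarrow> 'i \<times> real \<Rightarrow> ereal" where
  "LID1_obj b = (\<lambda>(t, l). ereal (- (l * b t)))"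

text \<open>A family indexed by \<open>T\<close> is a function on the index type whose values outside \<open>T\<close>
  are irrelevant.\<close>

definition supp :: "'i set \<Rightarrow> ('i \<Rightarrow> real) \<Rightarrow> 'i set" where
  "supp T l = {t \<in> T. l t \<noteq> 0}"

definition nonneg_finsupp :: "'i set \<Rightarrow> ('i \<Rightarrow> real) set" where
  "nonneg_finsupp T = {l. (\<forall>t\<in>T. 0 \<le> l t) \<and> finite (supp T l)}"

definition LID2_feasible ::
    "'i set \<Rightarrow> ('i \<Rightarrow> 'a::lc_hausdorff_tvs dual) \<Rightarrow> 'a dual \<Rightarrow> ('i \<Rightarrow> real) set" where
  "LID2_feasible T a c = {l \<in> nonneg_finsupp T. c = - (\<Sum>t\<in>supp T l. l t *\<^sub>R a t)}"

definition LID2_obj :: "'i set \<Rightarrow> ('i \<Rightarrow> real) \<Rightarrow> ('i \<Rightarrow> real) \<Rightarrow> ereal" where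
  "LID2_obj T b l = ereal (- (\<Sum>t\<in>supp T l. l t * b t))"

definition LID3_obj ::
    "'i set \<Rightarrow> ('i \<Rightarrow> 'a::lc_hausdorff_tvs dual) \<Rightarrow> ('i \<Rightarrow> real) \<Rightarrow> 'a dual \<Rightarrow> real \<Rightarrow> ereal" where
  "LID3_obj T a b c l =
    (INF x. SUP t\<in>T. ereal (dual_apply c x + dual_apply (l *\<^sub>R a t) x - l * b t))"

section \<open>The associated subsets of the product of the dual with the reals\<close>

text \<open>By \<open>cone_hull_expl\<close>, \<^term>\<open>cone hull B\<close> is the set of all nonnegative multiples of
  elements of \<open>B\<close>; it need not be convex.\<close>

definition E1 ::
    "'i set \<Rightarrow> ('i \<Rightarrow> 'a::lc_hausdorff_tvs dual) \<Rightarrow> ('i \<Rightarrow> real) \<Rightarrow> ('a dual \<times> real) set" where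
  "E1 T a b = (\<Union>t\<in>T. convex hull (cone hull {(a t, b t), (0, 1)}))"

definition E2 ::
    "'i set \<Rightarrow> ('i \<Rightarrow> 'a::lc_hausdorff_tvs dual) \<Rightarrow> ('i \<Rightarrow> real) \<Rightarrow> ('a dual \<times> real) set" where
  "E2 T a b = convex hull (cone hull ({(a t, b t) | t. t \<in> T} \<union> {(0, 1)}))"

definition E3 ::
    "'i set \<Rightarrow> ('i \<Rightarrow> 'a::lc_hausdorff_tvs dual) \<Rightarrow> ('i \<Rightarrow> real) \<Rightarrow> ('a dual \<times> real) set" where
  "E3 T a b = cone hull (closure (convex hull ({(a t, b t) | t. t \<in> T} \<union> {(0, 1)})))"

end

(* For each dual, let E be the set of all (-c, -r) such that some dual feasible point has value at
   least r. Stable strong duality says exactly that E equals the cone K of all (u, v) for which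
   u(x) <= v holds on the whole feasible set. By Farkas' lemma, a convex cone C contained in K and
   containing all (a_t, b_t) and (0, 1) is weak* dense in K.

   For the first two duals E is E1 or E2. For the third dual E is contained in E3 and may differ
   from it: E3 also contains points arising from the recession directions of the closed convex hull
   of the (a_t, b_t). However, E3 = K holds if and only if E = K. *)
theory Submission
  imports Defs
begin

text \<open>Continuous functionals on the weak* dual come from points of X, so a hyperplane
  separating a pair from a convex set of pairs is given by a point of X and a vertical slope.
  Feasibility enters three times: it keeps the primal value below infinity, so that a real lower
  bound makes it finite and attainment can be invoked; evaluation at a feasible point tilts vertical
  hyperplanes; and the same evaluation bounds vertical shifts when closures are taken.

  The obstacle lies in the third dual. A multiplier there measures the total weight put on the pairs
  (a_t, b_t), and the closed hull that also involves (0, 1) contains limits along which this weight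
  tends to 0 although the first component survives. The limit weight 0 is then useless as a
  multiplier. What rescues the equivalence is that K contains, along with such a limit, a lowest
  vertical translate that is nonpositive wherever all constraints are uniformly bounded above. If K
  = E3, this translate is represented in E3 too, and being lowest it cannot be a positive multiple
  of another limit of weight 0; so it has a multiplier, which also serves for the original point
  above it.\<close>

section \<open>Separation in the product of the weak* dual with the reals\<close>

text \<open>The separating functional comes from the nearest point to \<open>z\<close> in the coordinates \<open>f i\<close>: a
  minimizing sequence has Cauchy coordinates by the parallelogram law. A weak* neighbourhood
  involves only finitely many coordinates, so no infinite-dimensional Hahn-Banach theorem is needed.\<close>

lemma convex_separation_finite:
  fixes f :: "'i \<Rightarrow> 'v::real_vector \<Rightarrow> real"
  assumes fin: "finite I" and conv: "convex S" and ne: "S \<noteq> {}"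
    and lin: "\<And>i. i \<in> I \<Longrightarrow> linear (f i)" and e: "0 < e"
    and far: "\<And>s. s \<in> S \<Longrightarrow> \<exists>i\<in>I. e \<le> \<bar>f i s - f i z\<bar>"
  obtains w d where "0 < d"
    "\<And>s. s \<in> S \<Longrightarrow> (\<Sum>i\<in>I. w i * f i z) + d \<le> (\<Sum>i\<in>I. w i * f i s)"
proof -
  define Q where "Q s = (\<Sum>i\<in>I. (f i s - f i z)\<^sup>2)" for s
  define d where "d = Inf (Q ` S)"
  have Qe: "e\<^sup>2 \<le> Q s" if s: "s \<in> S" for s
  proof -
    obtain i where i: "i \<in> I" "e \<le> \<bar>f i s - f i z\<bar>" using far[OF s] by blast
    have "e\<^sup>2 \<le> (f i s - f i z)\<^sup>2" using i e by (simp add: abs_le_square_iff[symmetric])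
    also have "\<dots> \<le> Q s" unfolding Q_def by (rule member_le_sum) (use i fin in auto)
    finally show ?thesis .
  qed
  then have bdd: "bdd_below (Q ` S)" by (auto intro!: bdd_belowI)
  have d_le: "d \<le> Q s" if "s \<in> S" for s
    unfolding d_def using that bdd by (auto intro: cInf_lower)
  have "e\<^sup>2 \<le> d" unfolding d_def using ne Qe by (auto intro!: cInf_greatest)
  then have d_pos: "0 < d" using e by (smt (verit) zero_less_power)
  have "\<exists>y\<in>S. Q y < d + 1 / real (Suc k)" for k
    using cInf_lessD[of "Q ` S" "d + 1 / real (Suc k)"] ne unfolding d_def by auto
  then obtain y where yS: "\<And>k. y k \<in> S" and yQ: "\<And>k. Q (y k) < d + 1 / real (Suc k)"
    by metis
  have close: "(f i (y k) - f i (y l))\<^sup>2 \<le> 2 * (1 / real (Suc k) + 1 / real (Suc l))"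
    if i: "i \<in> I" for i k l
  proof -
    \<comment> \<open>The midpoint stays in \<open>S\<close>, so \<open>Q m\<close> is at least
      \<open>d\<close>; this turns the parallelogram identity into an upper bound for the distance
      of \<open>y k\<close> and \<open>y l\<close>.\<close>
    define m where "m = (1/2) *\<^sub>R y k + (1/2) *\<^sub>R y l"
    have mS: "m \<in> S" unfolding m_def by (rule convexD[OF conv]) (auto simp: yS)
    have "(f i (y k) - f i (y l))\<^sup>2 \<le> (\<Sum>i\<in>I. (f i (y k) - f i (y l))\<^sup>2)"
      by (rule member_le_sum) (use i fin in auto)
    also have "\<dots> = (\<Sum>i\<in>I. 2 * (f i (y k) - f i z)\<^sup>2 + 2 * (f i (y l) - f i z)\<^sup>2
        - 4 * (f i m - f i z)\<^sup>2)"
    proof (rule sum.cong)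
      fix i assume "i \<in> I"
      then have fm: "f i m = f i (y k) / 2 + f i (y l) / 2"
        unfolding m_def using lin by (simp add: linear_add linear_scale)
      show "(f i (y k) - f i (y l))\<^sup>2 = 2 * (f i (y k) - f i z)\<^sup>2 + 2 * (f i (y l) - f i z)\<^sup>2
          - 4 * (f i m - f i z)\<^sup>2"
        unfolding fm by (simp add: power2_eq_square field_simps)
    qed simp
    also have "\<dots> = 2 * Q (y k) + 2 * Q (y l) - 4 * Q m"
      unfolding Q_def by (simp add: sum.distrib sum_subtractf sum_distrib_left)
    also have "\<dots> \<le> 2 * (1 / real (Suc k) + 1 / real (Suc l))"
      using yQ[of k] yQ[of l] d_le[OF mS] by argo
    finally show ?thesis .
  qed
  have "convergent (\<lambda>k. f i (y k))" if i: "i \<in> I" for i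
  proof (intro real_Cauchy_convergent CauchyI')
    fix r :: real assume r: "0 < r"
    \<comment> \<open>The bound in \<open>close\<close> is twice a sum of two reciprocals; each
      below \<open>r\<^sup>2 / 4\<close> gives \<open>r\<^sup>2\<close>.\<close>
    obtain N where N: "4 / r\<^sup>2 < real N" using reals_Archimedean2 by blast
    have small: "1 / real (Suc k) < r\<^sup>2 / 4" if "N \<le> k" for k
    proof -
      have "4 / r\<^sup>2 < real (Suc k)" using N that by linarith
      then show ?thesis using r by (simp add: field_simps)
    qed
    have "dist (f i (y k)) (f i (y l)) < r" if "N \<le> k" "k < l" for k l
    proof -
      have "(f i (y k) - f i (y l))\<^sup>2 < r\<^sup>2"
        using close[OF i, of k l] small[OF that(1)] small[of l] that by simp
      then show ?thesis using r by (metis abs_le_square_iff abs_of_pos not_less dist_real_def)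
    qed
    then show "\<exists>M. \<forall>m\<ge>M. \<forall>n>m. dist (f i (y m)) (f i (y n)) < r" by blast
  qed
  then obtain p where p: "\<And>i. i \<in> I \<Longrightarrow> (\<lambda>k. f i (y k)) \<longlonglongrightarrow> p i"
    unfolding convergent_def by metis
  define w where "w i = p i - f i z" for i
  have "(\<lambda>k. Q (y k)) \<longlonglongrightarrow> (\<Sum>i\<in>I. (w i)\<^sup>2)"
    unfolding Q_def w_def by (intro tendsto_intros p)
  moreover have "(\<lambda>k. Q (y k)) \<longlonglongrightarrow> d"
  proof (rule tendsto_sandwich[where f = "\<lambda>_. d" and h = "\<lambda>k. d + 1 / real (Suc k)"])
    show "\<forall>\<^sub>F k in sequentially. d \<le> Q (y k)" using d_le yS by simp
    show "\<forall>\<^sub>F k in sequentially. Q (y k) \<le> d + 1 / real (Suc k)"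
      using yQ less_imp_le by (intro always_eventually) blast
    show "(\<lambda>k. d + 1 / real (Suc k)) \<longlonglongrightarrow> d" 
      using tendsto_add[OF tendsto_const[of d] LIMSEQ_inverse_real_of_nat]
      by (simp add: inverse_eq_divide)
  qed simp
  ultimately have w2: "(\<Sum>i\<in>I. (w i)\<^sup>2) = d" by (rule LIMSEQ_unique)
  have "(\<Sum>i\<in>I. w i * f i z) + d \<le> (\<Sum>i\<in>I. w i * f i s)" if s: "s \<in> S" for s
  proof -
    define c where "c = (\<Sum>i\<in>I. w i * (f i s - p i))"
    define B where "B = (\<Sum>i\<in>I. (f i s - p i)\<^sup>2)"
    \<comment> \<open>First-order optimality of the nearest point. The limit \<open>p\<close> need
      not be the coordinate vector of a point of \<open>S\<close>, so the variation is made at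
      \<open>y k\<close> and passed to the limit; \<open>d\<close> then cancels and \<theta> divides
      out.\<close>
    have var: "0 \<le> 2 * c + \<theta> * B" if \<theta>: "0 < \<theta>" "\<theta> \<le> 1" for \<theta>
    proof -
      have "d \<le> Q ((1 - \<theta>) *\<^sub>R y k + \<theta> *\<^sub>R s)" for k
        by (intro d_le convexD[OF conv] yS s) (use \<theta> in auto)
      moreover have "Q ((1 - \<theta>) *\<^sub>R y k + \<theta> *\<^sub>R s)
          = (\<Sum>i\<in>I. ((1 - \<theta>) * f i (y k) + \<theta> * f i s - f i z)\<^sup>2)" for k
        unfolding Q_def by (rule sum.cong) (auto simp: lin linear_add linear_scale)
      ultimately have "d \<le> (\<Sum>i\<in>I. ((1 - \<theta>) * f i (y k) + \<theta> * f i s - f i z)\<^sup>2)" for k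
        by simp
      moreover have "(\<lambda>k. \<Sum>i\<in>I. ((1 - \<theta>) * f i (y k) + \<theta> * f i s - f i z)\<^sup>2)
          \<longlonglongrightarrow> (\<Sum>i\<in>I. ((1 - \<theta>) * p i + \<theta> * f i s - f i z)\<^sup>2)"
        by (intro tendsto_intros p)
      ultimately have "d \<le> (\<Sum>i\<in>I. ((1 - \<theta>) * p i + \<theta> * f i s - f i z)\<^sup>2)"
        by (intro LIMSEQ_le_const) auto
      also have "\<dots> = (\<Sum>i\<in>I. (w i)\<^sup>2 + \<theta> * (2 * (w i * (f i s - p i)) + \<theta> * (f i s - p i)\<^sup>2))"
        by (rule sum.cong) (auto simp: w_def power2_eq_square algebra_simps)
      also have "\<dots> = d + \<theta> * (2 * c + \<theta> * B)"
        unfolding c_def B_def by (simp add: sum.distrib sum_distrib_left distrib_left w2)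
      finally show ?thesis using \<theta> by (simp add: zero_le_mult_iff)
    qed
    have "0 \<le> c"
    proof (rule ccontr)
      assume "\<not> 0 \<le> c"
      then have c: "c < 0" by simp
      \<comment> \<open>This makes \<open>\<theta> * B\<close> at most \<open>- c\<close>, so
        \<open>2 * c + \<theta> * B\<close> is at most \<open>c\<close>, which is negative. Adding 1
        to \<open>B\<close> avoids a zero denominator.\<close>
      define \<theta> where "\<theta> = min 1 (- c / (B + 1))"
      have B: "0 \<le> B" unfolding B_def by (simp add: sum_nonneg)
      have "0 < - c / (B + 1)" using c B by (intro divide_pos_pos) auto
      then have "0 < \<theta>" "\<theta> \<le> 1" by (auto simp: \<theta>_def)
      then have "0 \<le> 2 * c + \<theta> * B" by (rule var)
      moreover have "\<theta> * B \<le> - c / (B + 1) * B"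
        using B by (intro mult_right_mono) (auto simp: \<theta>_def)
      moreover have "- c / (B + 1) * B \<le> - c" using c B by (simp add: field_simps)
      ultimately show False using c by linarith
    qed
    \<comment> \<open>The sum of the squares of \<open>w\<close> is \<open>d\<close>, so
      nonnegativity of \<open>c\<close> is exactly the claimed inequality: the gap is the squared
      distance.\<close>
    moreover have "c = (\<Sum>i\<in>I. w i * f i s) - (\<Sum>i\<in>I. w i * f i z) - (\<Sum>i\<in>I. (w i)\<^sup>2)"
      unfolding c_def sum_subtractf[symmetric]
      by (rule sum.cong) (auto simp: w_def power2_eq_square algebra_simps)
    ultimately show ?thesis using w2 by linarith
  qed
  with d_pos show ?thesis by (rule that)
qed

section \<open>The weak* topology through evaluations at points\<close>

lemma continuous_on_dualI:
  fixes f :: "'b::topological_space \<Rightarrow> 'a::lc_hausdorff_tvs dual"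
  assumes "\<And>x. continuous_on S (\<lambda>s. dual_apply (f s) x)"
  shows "continuous_on S f"
proof -
  have "continuous_on S (\<lambda>s. dual_apply (f s))"
    by (rule continuous_on_coordinatewise_then_product) (rule assms)
  then have *: "\<exists>A. open A \<and> A \<inter> S = (\<lambda>s. dual_apply (f s)) -` W \<inter> S" if "open W" for W
    using that unfolding continuous_on_open_invariant by blast
  show ?thesis
    unfolding continuous_on_open_invariant
  proof (intro allI impI)
    fix U :: "'a dual set"
    assume "open U"
    then obtain W where "open W" and U: "U = dual_apply -` W" unfolding open_dual_def by blast
    with *[of W] show "\<exists>A. open A \<and> A \<inter> S = f -` U \<inter> S" by (auto simp: vimage_def)
  qed
qed

lemma continuous_on_dual_apply [continuous_intros]:
  assumes "continuous_on S f"
  shows "continuous_on S (\<lambda>s. dual_apply (f s) x)"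
proof -
  have "continuous_on UNIV (\<lambda>u :: 'b dual. dual_apply u)"
    unfolding continuous_on_open_vimage[OF open_UNIV] open_dual_def by auto
  then have "continuous_on UNIV (\<lambda>u :: 'b dual. dual_apply u x)"
    by (rule continuous_on_product_then_coordinatewise)
  from continuous_on_compose2[OF this assms] show ?thesis by simp
qed

lemma linear_dual_apply: "linear (dual_apply u)"
  using dual_apply[of u] by simp

lemma dual_eqI: "(\<And>x. dual_apply u x = dual_apply v x) \<Longrightarrow> u = v"
  by (simp add: dual_apply_inject[symmetric] fun_eq_iff)

lemmas dual_apply_simps [simp] =
  zero_dual.rep_eq plus_dual.rep_eq minus_dual.rep_eq uminus_dual.rep_eq scaleR_dual.rep_eq

text \<open>A basic open box of the product topology restricts only finitely many coordinates, so
  one radius serves all of them.\<close>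

lemma open_dual_contains_nbhd:
  assumes "open U" "u \<in> U"
  obtains J e where "finite J" "0 < e"
    "\<And>v. (\<And>x. x \<in> J \<Longrightarrow> \<bar>dual_apply v x - dual_apply u x\<bar> < e) \<Longrightarrow> v \<in> U"
proof -
  obtain W where W: "open W" "U = dual_apply -` W"
    using assms(1) unfolding open_dual_def by blast
  then have "openin (product_topology (\<lambda>i. euclidean) UNIV) W" "dual_apply u \<in> W"
    using assms(2) by (auto simp: open_fun_def)
  from product_topology_open_contains_basis[OF this]
  obtain X where X: "dual_apply u \<in> (\<Pi>\<^sub>E i\<in>UNIV. X i)" "\<And>i. open (X i)"
    "finite {i. X i \<noteq> UNIV}" "(\<Pi>\<^sub>E i\<in>UNIV. X i) \<subseteq> W"
    by auto
  have "\<exists>r>0. \<forall>s. \<bar>s - dual_apply u i\<bar> < r \<longrightarrow> s \<in> X i" for i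
  proof -
    have "dual_apply u i \<in> X i" using X(1) by (rule PiE_mem) simp
    with X(2)[of i] show ?thesis unfolding open_dist dist_real_def by blast
  qed
  then obtain r where r: "\<And>i. 0 < r i" "\<And>i s. \<bar>s - dual_apply u i\<bar> < r i \<Longrightarrow> s \<in> X i"
    by metis
  define J where "J = {i. X i \<noteq> UNIV}"
  \<comment> \<open>Inserting 1 keeps the minimum meaningful when no coordinate is
    restricted.\<close>
  define e where "e = Min (insert 1 (r ` J))"
  have J: "finite J" using X(3) by (simp add: J_def)
  have "0 < e" unfolding e_def using J r(1) by auto
  have le: "e \<le> r i" if "i \<in> J" for i unfolding e_def using J that by (intro Min_le) auto
  show ?thesis
  proof (rule that[OF J \<open>0 < e\<close>])
    fix v assume v: "\<And>x. x \<in> J \<Longrightarrow> \<bar>dual_apply v x - dual_apply u x\<bar> < e"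
    have "dual_apply v i \<in> X i" for i
    proof (cases "i \<in> J")
      case True
      then show ?thesis using v[OF True] le[OF True] by (intro r(2)) linarith
    qed (simp add: J_def)
    then have "dual_apply v \<in> W" using X(4) by (auto simp: PiE_def)
    then show "v \<in> U" using W by simp
  qed
qed

text \<open>The neighbourhood of \<open>z\<close> missing \<open>S\<close> tests finitely many
  points and the real coordinate, which reduces to the finite case. A weighted sum of evaluations is
  evaluation at the weighted sum of the points, so the separating functional is a point of the
  space.\<close>

lemma dual_prod_separation:
  fixes S :: "('a::lc_hausdorff_tvs dual \<times> real) set"
  assumes conv: "convex S" and ne: "S \<noteq> {}" and z: "z \<notin> closure S"
  obtains d x \<alpha> where "0 < d"
    "\<forall>s\<in>S. dual_apply (fst z) x + \<alpha> * snd z + d \<le> dual_apply (fst s) x + \<alpha> * snd s"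
proof -
  have "open (- closure S)" "z \<in> - closure S" using z by auto
  then obtain A B where AB: "open A" "open B" "z \<in> A \<times> B" "A \<times> B \<subseteq> - closure S"
    by (rule open_prod_elim)
  obtain J r where J: "finite J" "0 < r"
    "\<And>v. (\<And>x. x \<in> J \<Longrightarrow> \<bar>dual_apply v x - dual_apply (fst z) x\<bar> < r) \<Longrightarrow> v \<in> A"
    using open_dual_contains_nbhd[of A "fst z"] AB by (metis mem_Times_iff)
  obtain q where q: "0 < q" "\<And>s. \<bar>s - snd z\<bar> < q \<Longrightarrow> s \<in> B"
    using AB(2,3) unfolding open_dist dist_real_def mem_Times_iff by blast
  \<comment> \<open>\<open>None\<close> is the real coordinate, \<open>Some x\<close> the evaluation
    at \<open>x\<close>.\<close>
  define f where "f i s = (case i of None \<Rightarrow> snd s | Some x \<Rightarrow> dual_apply (fst s) x)"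
    for i and s :: "'a dual \<times> real"
  define I where "I = insert None (Some ` J)"
  obtain w d where wd: "0 < d"
    "\<And>s. s \<in> S \<Longrightarrow> (\<Sum>i\<in>I. w i * f i z) + d \<le> (\<Sum>i\<in>I. w i * f i s)"
  proof (rule convex_separation_finite)
    show "finite I" using J by (simp add: I_def)
    show "linear (f i)" for i
      by (rule linearI) (auto simp: f_def split: option.splits)
    show "\<exists>i\<in>I. min r q \<le> \<bar>f i s - f i z\<bar>" if "s \<in> S" for s
    proof (rule ccontr)
      assume "\<not> ?thesis"
      then have far: "\<bar>f i s - f i z\<bar> < min r q" if "i \<in> I" for i using that by force
      have "fst s \<in> A" using far[of "Some x" for x] by (intro J) (auto simp: I_def f_def)
      moreover have "snd s \<in> B" using far[of None] by (intro q) (auto simp: I_def f_def)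
      ultimately show False
        using that AB(4) closure_subset[of S] by (auto simp: mem_Times_iff)
    qed
  qed (use conv ne J q in auto)
  define x where "x = (\<Sum>i\<in>J. w (Some i) *\<^sub>R i)"
  have "(\<Sum>i\<in>I. w i * f i s) = dual_apply (fst s) x + w None * snd s" for s
    using J(1) unfolding I_def x_def f_def
    by (simp add: sum.reindex linear_sum[OF linear_dual_apply] linear_scale[OF linear_dual_apply])
  then show ?thesis using that[OF wd(1), of x "w None"] wd(2) by (simp add: algebra_simps)
qed

text \<open>A pair encodes the inequality \<open>aff z x \<le> 0\<close>. For fixed \<open>x\<close>
  the expression is linear and continuous in \<open>z\<close>, so sets of pairs cut out by such
  inequalities are closed convex cones.\<close>

definition aff :: "'a::lc_hausdorff_tvs dual \<times> real \<Rightarrow> 'a \<Rightarrow> real" where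
  "aff z x = dual_apply (fst z) x - snd z"

lemma aff_simps [simp]:
  "aff (y + z) x = aff y x + aff z x" "aff (r *\<^sub>R z) x = r * aff z x" "aff (0, s) x = - s"
  "aff 0 x = 0" "aff (- y) x = - aff y x" "aff (y - z) x = aff y x - aff z x"
  by (simp_all add: aff_def algebra_simps)

lemma continuous_on_aff [continuous_intros]:
  "continuous_on S f \<Longrightarrow> continuous_on S (\<lambda>s. aff (f s) x)"
  unfolding aff_def by (intro continuous_intros)

text \<open>The bound at \<open>x0\<close> excludes vertical separating hyperplanes: they are tilted by moving far
  away from \<open>x0\<close>.\<close>

lemma upward_closed_separation:
  fixes S :: "('a::lc_hausdorff_tvs dual \<times> real) set"
  assumes conv: "convex S" and ne: "S \<noteq> {}" and z: "z \<notin> closure S"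
    and up: "\<And>s r. s \<in> S \<Longrightarrow> 0 \<le> r \<Longrightarrow> s + (0, r) \<in> S"
    and x0: "\<And>s. s \<in> S \<Longrightarrow> aff s x0 \<le> N"
  obtains \<beta> y where "\<beta> < aff z y" "\<forall>s\<in>S. aff s y \<le> \<beta>"
proof -
  obtain d x \<alpha> where d: "0 < d" and
    "\<forall>s\<in>S. dual_apply (fst z) x + \<alpha> * snd z + d \<le> dual_apply (fst s) x + \<alpha> * snd s"
    by (rule dual_prod_separation[OF conv ne z])
  then have sep: "dual_apply (fst z) x + \<alpha> * snd z + d \<le> dual_apply (fst s) x + \<alpha> * snd s"
    if "s \<in> S" for s
    using that by blast
  obtain s0 where s0: "s0 \<in> S" using ne by blast
  define \<gamma> where "\<gamma> = dual_apply (fst z) x + \<alpha> * snd z + d"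
  have "0 \<le> \<alpha>"
  proof (rule ccontr)
    assume neg: "\<not> 0 \<le> \<alpha>"
    define k where "k = dual_apply (fst s0) x + \<alpha> * snd s0 - \<gamma>"
    have "0 \<le> k" using sep[OF s0] by (simp add: k_def \<gamma>_def)
    \<comment> \<open>Raising \<open>s0\<close> by this amount lowers the functional by
      \<open>k + 1\<close>, just past the slack \<open>k\<close> that the separation leaves.\<close>
    define r where "r = (k + 1) / - \<alpha>"
    have "0 \<le> r" unfolding r_def using neg \<open>0 \<le> k\<close> by (intro divide_nonneg_pos) auto
    from sep[OF up[OF s0 this]] have "0 \<le> k + \<alpha> * r"
      by (simp add: k_def \<gamma>_def algebra_simps)
    moreover have "\<alpha> * r = - (k + 1)" using neg by (simp add: r_def field_simps)
    ultimately show False by linarith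
  qed
  then consider "0 < \<alpha>" | "\<alpha> = 0" by linarith
  then show ?thesis
  proof cases
    case 1
    define y where "y = (- 1 / \<alpha>) *\<^sub>R x"
    have aff_y: "aff s y = - (dual_apply (fst s) x + \<alpha> * snd s) / \<alpha>" for s
      using 1 by (simp add: aff_def y_def linear_scale[OF linear_dual_apply]
          linear_neg[OF linear_dual_apply] field_simps)
    show ?thesis
    proof (rule that[of "- \<gamma> / \<alpha>" y, OF _ ballI])
      show "- \<gamma> / \<alpha> < aff z y" using 1 d by (simp add: aff_y \<gamma>_def divide_strict_right_mono)
      show "aff s y \<le> - \<gamma> / \<alpha>" if "s \<in> S" for s
        unfolding aff_y using sep[OF that] 1 by (intro divide_right_mono) (auto simp: \<gamma>_def)
    qed
  next
    case 2
    \<comment> \<open>Along the vertical hyperplane the gap grows to \<open>k * d\<close>, which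
      must exceed the deficit \<open>N - aff z x0\<close>; the 1 makes this strict.\<close>
    define k where "k = max 0 ((N - aff z x0) / d + 1)"
    have k: "0 \<le> k" "N - aff z x0 < k * d"
    proof -
      have "(N - aff z x0) / d < k" by (simp add: k_def)
      then show "N - aff z x0 < k * d" using d by (simp add: field_simps)
    qed (simp add: k_def)
    define y where "y = x0 - k *\<^sub>R x"
    have aff_y: "aff s y = aff s x0 - k * dual_apply (fst s) x" for s
      by (simp add: aff_def y_def linear_scale[OF linear_dual_apply] linear_diff[OF linear_dual_apply])
    show ?thesis
    proof (rule that[of "N - k * \<gamma>" y, OF _ ballI])
      show "N - k * \<gamma> < aff z y" using k by (simp add: aff_y \<gamma>_def 2 algebra_simps)
      show "aff s y \<le> N - k * \<gamma>" if "s \<in> S" for s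
      proof -
        have "k * \<gamma> \<le> k * dual_apply (fst s) x"
          using sep[OF that] k(1) by (intro mult_left_mono) (auto simp: \<gamma>_def 2)
        then show ?thesis using x0[OF that] by (simp add: aff_y)
      qed
    qed
  qed
qed

section \<open>Stable duality as equality with the cone of consequences\<close>

text \<open>The epigraph of the support function of the feasible set.\<close>

definition consequences ::
    "'i set \<Rightarrow> ('i \<Rightarrow> 'a::lc_hausdorff_tvs dual) \<Rightarrow> ('i \<Rightarrow> real) \<Rightarrow> ('a dual \<times> real) set" where
  "consequences T a b = {z. \<forall>x\<in>feasible T a b. aff z x \<le> 0}"

lemma consequencesD: "z \<in> consequences T a b \<Longrightarrow> x \<in> feasible T a b \<Longrightarrow> aff z x \<le> 0"
  by (simp add: consequences_def)

lemma feasible_iff_aff: "x \<in> feasible T a b \<longleftrightarrow> (\<forall>t\<in>T. aff (a t, b t) x \<le> 0)"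
  by (simp add: feasible_def aff_def)

lemma closed_consequences: "closed (consequences T a b)"
  unfolding consequences_def Ball_def
  by (intro closed_Collect_all closed_Collect_imp open_Collect_const closed_Collect_le
      continuous_intros)

lemma convex_cone_consequences: "convex (consequences T a b)" "cone (consequences T a b)"
proof -
  have "convex (consequences T a b) \<and> cone (consequences T a b)"
    unfolding convex_cone
    by (auto simp: consequences_def mult_nonneg_nonpos intro: add_nonpos_nonpos)
  then show "convex (consequences T a b)" "cone (consequences T a b)" by auto
qed

lemma generators_subset_consequences:
  "{(a t, b t) | t. t \<in> T} \<union> {(0, 1)} \<subseteq> consequences T a b"
  by (auto simp: consequences_def feasible_iff_aff)

text \<open>Asking for a dual point with value at least a real \<open>r\<close>, for every
  \<open>r\<close> below the primal value, encodes equality of the values and attainment at once.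
  Leaving \<open>D\<close>, \<open>g\<close> and \<open>E\<close> abstract lets one argument serve
  all three duals.\<close>

lemma stable_duality_iff:
  assumes feas: "feasible T a b \<noteq> {}"
    and E: "\<And>c r. (\<exists>d\<in>D c. ereal r \<le> g c d) \<longleftrightarrow> (- c, - r) \<in> E"
  shows "(\<forall>c. inf_eq_max (inf_LIP T a b c) (D c) (g c)) \<longleftrightarrow> E = consequences T a b"
proof -
  have V: "ereal r \<le> inf_LIP T a b c \<longleftrightarrow> (- c, - r) \<in> consequences T a b" for c r
    by (auto simp: inf_LIP_def le_INF_iff consequences_def aff_def)
  have V_less: "inf_LIP T a b c \<noteq> \<infinity>" for c
  proof -
    obtain x where "x \<in> feasible T a b" using feas by blast
    then have "inf_LIP T a b c \<le> ereal (dual_apply c x)"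
      unfolding inf_LIP_def by (rule INF_lower)
    then show ?thesis by auto
  qed
  show ?thesis
  proof
    assume dual: "\<forall>c. inf_eq_max (inf_LIP T a b c) (D c) (g c)"
    have "(u, v) \<in> E \<longleftrightarrow> (u, v) \<in> consequences T a b" for u v
    proof -
      have p: "inf_LIP T a b (- u) = (SUP d\<in>D (- u). g (- u) d)"
        and att: "\<bar>inf_LIP T a b (- u)\<bar> \<noteq> \<infinity> \<Longrightarrow>
          \<exists>d\<in>D (- u). g (- u) d = (SUP d\<in>D (- u). g (- u) d)"
        using dual by (auto simp: inf_eq_max_def)
      have "(\<exists>d\<in>D (- u). ereal (- v) \<le> g (- u) d) \<longleftrightarrow> ereal (- v) \<le> inf_LIP T a b (- u)"
      proof
        assume "\<exists>d\<in>D (- u). ereal (- v) \<le> g (- u) d"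
        then show "ereal (- v) \<le> inf_LIP T a b (- u)" unfolding p by (auto intro: SUP_upper2)
      next
        assume le: "ereal (- v) \<le> inf_LIP T a b (- u)"
        then have "\<bar>inf_LIP T a b (- u)\<bar> \<noteq> \<infinity>"
          using V_less[of "- u"] by (cases "inf_LIP T a b (- u)") auto
        from att[OF this] show "\<exists>d\<in>D (- u). ereal (- v) \<le> g (- u) d" using le p by metis
      qed
      then show ?thesis using E[where c = "- u" and r = "- v"] V[where c = "- u" and r = "- v"] by simp
    qed
    then show "E = consequences T a b" by auto
  next
    assume eq: "E = consequences T a b"
    have key: "(\<exists>d\<in>D c. ereal r \<le> g c d) \<longleftrightarrow> ereal r \<le> inf_LIP T a b c" for c r
      using E V eq by simp
    show "\<forall>c. inf_eq_max (inf_LIP T a b c) (D c) (g c)"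
    proof
      fix c
      \<comment> \<open>\<open>key\<close> speaks of real levels only, so a violation between
        extended values is tested at a real number strictly in between.\<close>
      have ub: "g c d \<le> inf_LIP T a b c" if "d \<in> D c" for d
      proof (rule ccontr)
        assume "\<not> ?thesis"
        then obtain r where "inf_LIP T a b c < ereal r" "ereal r < g c d"
          using ereal_dense2 by (metis not_le)
        then show False using key[where r = r and c = c] that by (meson less_imp_le not_le)
      qed
      have "inf_LIP T a b c \<le> (SUP d\<in>D c. g c d)"
      proof (rule ccontr)
        assume "\<not> ?thesis"
        then obtain r where r: "(SUP d\<in>D c. g c d) < ereal r" "ereal r < inf_LIP T a b c"
          using ereal_dense2 by (metis not_le)
        then obtain d where "d \<in> D c" "ereal r \<le> g c d"
          using key[where r = r and c = c] by (meson less_imp_le)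
        then have "ereal r \<le> (SUP d\<in>D c. g c d)" by (rule SUP_upper2)
        then show False using r by simp
      qed
      then have eqV: "inf_LIP T a b c = (SUP d\<in>D c. g c d)"
        using ub by (intro antisym SUP_least)
      have "\<exists>d\<in>D c. g c d = (SUP d\<in>D c. g c d)" if fin: "\<bar>inf_LIP T a b c\<bar> \<noteq> \<infinity>"
      proof -
        obtain r where r: "inf_LIP T a b c = ereal r" using fin by auto
        then obtain d where "d \<in> D c" "ereal r \<le> g c d"
          using key[where r = r and c = c] by auto
        then show ?thesis using ub[of d] r eqV by (metis antisym)
      qed
      then show "inf_eq_max (inf_LIP T a b c) (D c) (g c)"
        unfolding inf_eq_max_def using eqV by blast
    qed
  qed
qed

text \<open>A point \<open>y\<close> separating \<open>z\<close> from \<open>C\<close> bounds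
  \<open>aff s y\<close> above on the cone, hence by 0. Since \<open>C\<close> contains the
  generators, \<open>y\<close> is feasible, and there \<open>z\<close> fails to be a
  consequence.\<close>

lemma consequences_subset_closure:
  fixes C :: "('a::lc_hausdorff_tvs dual \<times> real) set"
  assumes feas: "feasible T a b \<noteq> {}" and conv: "convex C" "cone C"
    and gen: "{(a t, b t) | t. t \<in> T} \<union> {(0, 1)} \<subseteq> C" and sub: "C \<subseteq> consequences T a b"
  shows "consequences T a b \<subseteq> closure C"
proof
  fix z assume z: "z \<in> consequences T a b"
  obtain x0 where x0: "x0 \<in> feasible T a b" using feas by blast
  have add: "x + y \<in> C" if "x \<in> C" "y \<in> C" for x y
    using conv that convex_cone[of C] by blast
  have scale: "r *\<^sub>R x \<in> C" if "x \<in> C" "0 \<le> r" for x r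
    using conv that by (auto simp: cone_def)
  have up: "s + (0, r) \<in> C" if "s \<in> C" "0 \<le> r" for s r
    using add[OF that(1) scale[of "(0, 1)" r]] gen that by simp
  show "z \<in> closure C"
  proof (rule ccontr)
    assume "z \<notin> closure C"
    moreover have "C \<noteq> {}" using gen by auto
    moreover have "aff s x0 \<le> 0" if "s \<in> C" for s
      using sub that x0 by (intro consequencesD) auto
    ultimately obtain \<beta> y where \<beta>: "\<beta> < aff z y" and "\<forall>s\<in>C. aff s y \<le> \<beta>"
      using upward_closed_separation[OF conv(1) _ _ up, of z x0 0] by metis
    then have y: "aff s y \<le> \<beta>" if "s \<in> C" for s using that by blast
    have "0 \<in> C" using scale[of "(0, 1)" 0] gen by (simp add: zero_prod_def)
    from y[OF this] have "0 \<le> \<beta>" by simp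
    have "aff s y \<le> 0" if s: "s \<in> C" for s
    proof (rule ccontr)
      assume "\<not> ?thesis"
      then have pos: "0 < aff s y" by simp
      \<comment> \<open>The multiple of \<open>s\<close> whose value at \<open>y\<close> is
        \<open>\<beta> + 1\<close>.\<close>
      define k where "k = (\<beta> + 1) / aff s y"
      have "0 \<le> k" unfolding k_def using pos \<open>0 \<le> \<beta>\<close> by (intro divide_nonneg_pos) auto
      from y[OF scale[OF s this]] show False using pos by (simp add: k_def)
    qed
    then have "y \<in> feasible T a b" using gen by (auto simp: feasible_iff_aff)
    from consequencesD[OF z this] show False using \<beta> \<open>0 \<le> \<beta>\<close> by simp
  qed
qed

lemma closed_convex_cone_eq_consequences:
  assumes "feasible T a b \<noteq> {}" "convex C" "cone C" "closed C"
    and "{(a t, b t) | t. t \<in> T} \<union> {(0, 1)} \<subseteq> C" "C \<subseteq> consequences T a b"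
  shows "C = consequences T a b"
  using consequences_subset_closure[of T a b C] assms by (auto simp: closure_closed)

section \<open>The first two duals\<close>

lemma convex_hull_cone_hull_pair:
  fixes p q :: "'v::real_vector"
  shows "convex hull (cone hull {p, q}) = {l *\<^sub>R p + r *\<^sub>R q | l r. 0 \<le> l \<and> 0 \<le> r}" (is "_ = ?C")
proof
  have "convex ?C \<and> cone ?C"
    unfolding convex_cone
  proof (intro conjI ballI allI impI)
    fix x y assume "x \<in> ?C" "y \<in> ?C"
    then obtain l r l' r' where
      "x = l *\<^sub>R p + r *\<^sub>R q" "0 \<le> l" "0 \<le> r" "y = l' *\<^sub>R p + r' *\<^sub>R q" "0 \<le> l'" "0 \<le> r'" by blast
    then have "x + y = (l + l') *\<^sub>R p + (r + r') *\<^sub>R q \<and> 0 \<le> l + l' \<and> 0 \<le> r + r'"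
      by (simp add: algebra_simps)
    then show "x + y \<in> ?C" by blast
  next
    fix x and c :: real assume "x \<in> ?C" "0 \<le> c"
    then obtain l r where "x = l *\<^sub>R p + r *\<^sub>R q" "0 \<le> l" "0 \<le> r" by blast
    then have "c *\<^sub>R x = (c * l) *\<^sub>R p + (c * r) *\<^sub>R q \<and> 0 \<le> c * l \<and> 0 \<le> c * r"
      using \<open>0 \<le> c\<close> by (simp add: algebra_simps)
    then show "c *\<^sub>R x \<in> ?C" by blast
  qed
  moreover have "{p, q} \<subseteq> ?C"
  proof -
    have "p = 1 *\<^sub>R p + 0 *\<^sub>R q" "q = 0 *\<^sub>R p + 1 *\<^sub>R q" by simp_all
    then show ?thesis by (metis (mono_tags, lifting) CollectI empty_subsetI insert_subset order_refl zero_le_one)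
  qed
  ultimately show "convex hull (cone hull {p, q}) \<subseteq> ?C" by (intro hull_minimal) auto
next
  let ?H = "convex hull (cone hull {p, q})"
  have H: "convex ?H \<and> cone ?H" by (simp add: cone_convex_hull cone_cone_hull)
  have "p \<in> ?H" "q \<in> ?H" by (simp_all add: hull_inc)
  then show "?C \<subseteq> ?H" using H unfolding convex_cone by blast
qed

lemma E1_eq:
  "E1 T a b = {(l *\<^sub>R a t, l * b t + r) | t l r. t \<in> T \<and> 0 \<le> l \<and> 0 \<le> r}"
  unfolding E1_def convex_hull_cone_hull_pair by auto

text \<open>A union over \<open>t\<close> is a cone but may fail to be convex, and Farkas' lemma
  needs convexity; conversely \<open>consequences\<close> has both properties.\<close>

lemma E1_closed_convex_iff:
  assumes "T \<noteq> {}" "feasible T a b \<noteq> {}"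
  shows "closed (E1 T a b) \<and> convex (E1 T a b) \<longleftrightarrow> E1 T a b = consequences T a b"
proof
  assume *: "closed (E1 T a b) \<and> convex (E1 T a b)"
  show "E1 T a b = consequences T a b"
  proof (rule closed_convex_cone_eq_consequences)
    show "cone (E1 T a b)"
    proof (unfold cone_def, intro ballI allI impI)
      fix z and c :: real assume "z \<in> E1 T a b" "0 \<le> c"
      then obtain t l r where "t \<in> T" "0 \<le> l" "0 \<le> r" "z = (l *\<^sub>R a t, l * b t + r)"
        unfolding E1_eq by blast
      then have "c *\<^sub>R z = ((c * l) *\<^sub>R a t, (c * l) * b t + c * r) \<and> 0 \<le> c * l \<and> 0 \<le> c * r"
        using \<open>0 \<le> c\<close> by (simp add: algebra_simps)
      then show "c *\<^sub>R z \<in> E1 T a b" unfolding E1_eq using \<open>t \<in> T\<close> by blast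
    qed
    show "{(a t, b t) | t. t \<in> T} \<union> {(0, 1)} \<subseteq> E1 T a b"
      unfolding E1_def using \<open>T \<noteq> {}\<close> by (auto simp: hull_inc)
    show "E1 T a b \<subseteq> consequences T a b"
      unfolding E1_def
      by (intro UN_least hull_minimal convex_cone_consequences)
        (use generators_subset_consequences[of a b T] in auto)
  qed (use assms * in auto)
next
  assume "E1 T a b = consequences T a b"
  then show "closed (E1 T a b) \<and> convex (E1 T a b)"
    by (simp add: closed_consequences convex_cone_consequences)
qed

text \<open>The slack between \<open>r\<close> and the dual objective is the coefficient of
  \<open>(0, 1)\<close>.\<close>

lemma LID1_iff_E1:
  "(\<exists>d\<in>LID1_feasible T a c. ereal r \<le> LID1_obj b d) \<longleftrightarrow> (- c, - r) \<in> E1 T a b"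
proof
  assume "\<exists>d\<in>LID1_feasible T a c. ereal r \<le> LID1_obj b d"
  then obtain t l where "t \<in> T" "0 \<le> l" "c = - (l *\<^sub>R a t)" "r \<le> - (l * b t)"
    by (auto simp: LID1_feasible_def LID1_obj_def)
  then have "(- c, - r) = (l *\<^sub>R a t, l * b t + (- r - l * b t)) \<and> 0 \<le> - r - l * b t" by simp
  then show "(- c, - r) \<in> E1 T a b" unfolding E1_eq using \<open>t \<in> T\<close> \<open>0 \<le> l\<close> by blast
next
  assume "(- c, - r) \<in> E1 T a b"
  then obtain t l s where "t \<in> T" "0 \<le> l" "0 \<le> s" and eq: "- c = l *\<^sub>R a t" "- r = l * b t + s"
    unfolding E1_eq by auto
  have "c = - (l *\<^sub>R a t)" "r \<le> - (l * b t)" using eq \<open>0 \<le> s\<close> by (auto simp flip: eq(1))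
  then show "\<exists>d\<in>LID1_feasible T a c. ereal r \<le> LID1_obj b d"
    using \<open>t \<in> T\<close> \<open>0 \<le> l\<close> by (intro bexI[of _ "(t, l)"]) (auto simp: LID1_feasible_def LID1_obj_def)
qed

text \<open>Brings sums over different supports to a common index set.\<close>

lemma sum_supp_eq:
  fixes h :: "'i \<Rightarrow> 'v::real_vector"
  assumes "finite J" "supp T l \<subseteq> J" "J \<subseteq> T"
  shows "(\<Sum>t\<in>supp T l. l t *\<^sub>R h t) = (\<Sum>t\<in>J. l t *\<^sub>R h t)"
  by (rule sum.mono_neutral_left) (use assms in \<open>auto simp: supp_def\<close>)

lemma E2_eq:
  "E2 T a b = {(\<Sum>t\<in>supp T l. l t *\<^sub>R (a t, b t)) + (0, r) | l r. l \<in> nonneg_finsupp T \<and> 0 \<le> r}"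
  (is "_ = ?C")
proof
  have "convex ?C \<and> cone ?C"
    unfolding convex_cone
  proof (intro conjI ballI allI impI)
    fix x y assume "x \<in> ?C" "y \<in> ?C"
    then obtain l r l' r' where
      x: "x = (\<Sum>t\<in>supp T l. l t *\<^sub>R (a t, b t)) + (0, r)" "l \<in> nonneg_finsupp T" "0 \<le> r" and
      y: "y = (\<Sum>t\<in>supp T l'. l' t *\<^sub>R (a t, b t)) + (0, r')" "l' \<in> nonneg_finsupp T" "0 \<le> r'"
      by blast
    let ?l = "\<lambda>t. l t + l' t" and ?J = "supp T l \<union> supp T l'"
    have J: "finite ?J" "?J \<subseteq> T" "supp T ?l \<subseteq> ?J"
      using x(2) y(2) by (auto simp: nonneg_finsupp_def supp_def)
    have "(\<Sum>t\<in>supp T ?l. ?l t *\<^sub>R (a t, b t)) = (\<Sum>t\<in>?J. ?l t *\<^sub>R (a t, b t))"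
      by (rule sum_supp_eq) (use J in auto)
    also have "\<dots> = (\<Sum>t\<in>?J. l t *\<^sub>R (a t, b t)) + (\<Sum>t\<in>?J. l' t *\<^sub>R (a t, b t))"
      by (simp only: scaleR_add_left sum.distrib)
    also have "(\<Sum>t\<in>?J. l t *\<^sub>R (a t, b t)) = (\<Sum>t\<in>supp T l. l t *\<^sub>R (a t, b t))"
      by (rule sum_supp_eq[symmetric]) (use J in auto)
    also have "(\<Sum>t\<in>?J. l' t *\<^sub>R (a t, b t)) = (\<Sum>t\<in>supp T l'. l' t *\<^sub>R (a t, b t))"
      by (rule sum_supp_eq[symmetric]) (use J in auto)
    finally have "x + y = (\<Sum>t\<in>supp T ?l. ?l t *\<^sub>R (a t, b t)) + (0, r + r')"
      unfolding x(1) y(1) by (simp add: prod_eq_iff)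
    moreover have "?l \<in> nonneg_finsupp T"
      using x(2) y(2) J finite_subset by (auto simp: nonneg_finsupp_def)
    moreover have "0 \<le> r + r'" using x(3) y(3) by simp
    ultimately show "x + y \<in> ?C" by (intro CollectI exI[of _ ?l] exI[of _ "r + r'"] conjI)
  next
    fix x and c :: real assume "x \<in> ?C" and c: "0 \<le> c"
    then obtain l r where
      x: "x = (\<Sum>t\<in>supp T l. l t *\<^sub>R (a t, b t)) + (0, r)" "l \<in> nonneg_finsupp T" "0 \<le> r"
      by blast
    \<comment> \<open>For \<open>c = 0\<close> the support becomes empty, so only an inclusion
      between the supports is available.\<close>
    let ?l = "\<lambda>t. c * l t"
    have J: "finite (supp T l)" "supp T l \<subseteq> T" "supp T ?l \<subseteq> supp T l"
      using x(2) by (auto simp: nonneg_finsupp_def supp_def)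
    have "(\<Sum>t\<in>supp T ?l. ?l t *\<^sub>R (a t, b t)) = (\<Sum>t\<in>supp T l. ?l t *\<^sub>R (a t, b t))"
      by (rule sum_supp_eq) (use J in auto)
    also have "\<dots> = c *\<^sub>R (\<Sum>t\<in>supp T l. l t *\<^sub>R (a t, b t))"
      by (simp only: scaleR_sum_right scaleR_scaleR)
    finally have "c *\<^sub>R x = (\<Sum>t\<in>supp T ?l. ?l t *\<^sub>R (a t, b t)) + (0, c * r)"
      unfolding x(1) by (simp add: scaleR_add_right)
    moreover have "?l \<in> nonneg_finsupp T"
      using x(2) J c finite_subset by (auto simp: nonneg_finsupp_def)
    moreover have "0 \<le> c * r" using x(3) c by simp
    ultimately show "c *\<^sub>R x \<in> ?C" by (intro CollectI exI[of _ ?l] exI[of _ "c * r"] conjI)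
  qed
  moreover have "(a t, b t) \<in> ?C" if "t \<in> T" for t
  proof -
    let ?l = "\<lambda>s. if s = t then 1 else 0 :: real"
    have "supp T ?l = {t}" using that by (auto simp: supp_def)
    then have "?l \<in> nonneg_finsupp T" "(a t, b t) = (\<Sum>t\<in>supp T ?l. ?l t *\<^sub>R (a t, b t)) + (0, 0)"
      by (auto simp: nonneg_finsupp_def zero_prod_def[symmetric])
    then show ?thesis by (intro CollectI exI[of _ ?l] exI[of _ 0] conjI order_refl)
  qed
  moreover have "(0, 1) \<in> ?C"
  proof -
    let ?l = "\<lambda>_. 0 :: real"
    have "supp T ?l = {}" by (auto simp: supp_def)
    then have "?l \<in> nonneg_finsupp T" "(0, 1) = (\<Sum>t\<in>supp T ?l. ?l t *\<^sub>R (a t, b t)) + (0, 1)"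
      by (auto simp: nonneg_finsupp_def)
    then show ?thesis by (intro CollectI exI[of _ ?l] exI[of _ 1] conjI zero_le_one)
  qed
  ultimately show "E2 T a b \<subseteq> ?C" unfolding E2_def by (intro hull_minimal) auto
next
  have "convex (E2 T a b) \<and> cone (E2 T a b)" by (simp add: E2_def cone_convex_hull cone_cone_hull)
  then have add: "\<And>x y. x \<in> E2 T a b \<Longrightarrow> y \<in> E2 T a b \<Longrightarrow> x + y \<in> E2 T a b"
    and scale: "\<And>x c. x \<in> E2 T a b \<Longrightarrow> 0 \<le> c \<Longrightarrow> c *\<^sub>R x \<in> E2 T a b"
    unfolding convex_cone by blast+
  have gen: "(a t, b t) \<in> E2 T a b" if "t \<in> T" for t
    unfolding E2_def using that by (intro hull_inc) auto
  have e: "(0, r) \<in> E2 T a b" if "0 \<le> r" for r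
    using scale[of "(0, 1)" r] that by (auto simp: E2_def hull_inc)
  show "?C \<subseteq> E2 T a b"
  proof
    fix x assume "x \<in> ?C"
    then obtain l r where l: "l \<in> nonneg_finsupp T" and r: "0 \<le> r"
      and x: "x = (\<Sum>t\<in>supp T l. l t *\<^sub>R (a t, b t)) + (0, r)" by blast
    have "(\<Sum>t\<in>J. l t *\<^sub>R (a t, b t)) \<in> E2 T a b" if "finite J" "J \<subseteq> T" for J
      using that
    proof (induction J rule: finite_induct)
      case empty
      then show ?case using e[of 0] by (simp add: zero_prod_def)
    next
      case (insert t J)
      \<comment> \<open>Splitting a multiple of a pair by \<open>scaleR_Pair\<close> would keep
        \<open>scale\<close> and \<open>gen\<close> from matching.\<close>
      then show ?case using l by (auto simp del: scaleR_Pair simp: nonneg_finsupp_def intro!: add scale gen)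
    qed
    from this[of "supp T l"] have "(\<Sum>t\<in>supp T l. l t *\<^sub>R (a t, b t)) \<in> E2 T a b"
      using l by (auto simp: nonneg_finsupp_def supp_def)
    then show "x \<in> E2 T a b" unfolding x using e[OF r] by (rule add)
  qed
qed

lemma E2_closed_iff:
  assumes "feasible T a b \<noteq> {}"
  shows "closed (E2 T a b) \<longleftrightarrow> E2 T a b = consequences T a b"
proof
  assume "closed (E2 T a b)"
  then show "E2 T a b = consequences T a b"
  proof (rule closed_convex_cone_eq_consequences[OF assms, rotated 2])
    show "{(a t, b t) | t. t \<in> T} \<union> {(0, 1)} \<subseteq> E2 T a b"
      unfolding E2_def by (meson hull_subset order_trans)
    show "E2 T a b \<subseteq> consequences T a b"
      unfolding E2_def
      by (intro hull_minimal convex_cone_consequences generators_subset_consequences)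
  qed (auto simp: E2_def cone_convex_hull cone_cone_hull)
qed (simp add: closed_consequences)

lemma LID2_iff_E2:
  "(\<exists>d\<in>LID2_feasible T a c. ereal r \<le> LID2_obj T b d) \<longleftrightarrow> (- c, - r) \<in> E2 T a b"
proof -
  have pair: "(\<Sum>t\<in>supp T l. l t *\<^sub>R (a t, b t)) + (0, s)
      = (\<Sum>t\<in>supp T l. l t *\<^sub>R a t, (\<Sum>t\<in>supp T l. l t * b t) + s)" for l s
    by (simp add: prod_eq_iff fst_sum snd_sum)
  show ?thesis
  proof
    assume "\<exists>d\<in>LID2_feasible T a c. ereal r \<le> LID2_obj T b d"
    then obtain l where l: "l \<in> nonneg_finsupp T" and eq: "c = - (\<Sum>t\<in>supp T l. l t *\<^sub>R a t)"
      and r: "r \<le> - (\<Sum>t\<in>supp T l. l t * b t)"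
      by (auto simp: LID2_feasible_def LID2_obj_def)
    have "(- c, - r) = (\<Sum>t\<in>supp T l. l t *\<^sub>R (a t, b t))
        + (0, - r - (\<Sum>t\<in>supp T l. l t * b t))"
      unfolding pair by (simp add: eq)
    then show "(- c, - r) \<in> E2 T a b" unfolding E2_eq using l r by force
  next
    assume "(- c, - r) \<in> E2 T a b"
    then obtain l s where l: "l \<in> nonneg_finsupp T" and s: "0 \<le> s"
      and eq: "- c = (\<Sum>t\<in>supp T l. l t *\<^sub>R a t)" "- r = (\<Sum>t\<in>supp T l. l t * b t) + s"
      unfolding E2_eq pair by auto
    have "c = - (\<Sum>t\<in>supp T l. l t *\<^sub>R a t)" by (simp flip: eq(1))
    moreover have "r \<le> - (\<Sum>t\<in>supp T l. l t * b t)" using eq(2) s by linarith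
    ultimately show "\<exists>d\<in>LID2_feasible T a c. ereal r \<le> LID2_obj T b d"
      using l by (intro bexI[of _ l]) (auto simp: LID2_feasible_def LID2_obj_def)
  qed
qed

section \<open>The third dual\<close>

text \<open>By the tube lemma, a real parameter confined to a compact interval survives passage to
  closures.\<close>

lemma closed_compact_projection:
  fixes W :: "('b::topological_space \<times> 'c::topological_space) set"
  assumes "compact K" "closed W"
  shows "closed {z. \<exists>s\<in>K. (z, s) \<in> W}"
proof -
  have "open {z. \<forall>s\<in>K. (z, s) \<notin> W}"
  proof (subst open_subopen, rule ballI)
    fix z assume "z \<in> {z. \<forall>s\<in>K. (z, s) \<notin> W}"
    then have "{z} \<times> K \<subseteq> - W" by auto
    with Elementary_Topology.tube_lemma[OF \<open>compact K\<close>, of "- W" z] \<open>closed W\<close>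
    obtain X where "z \<in> X" "open X" "X \<times> K \<subseteq> - W" by auto
    then show "\<exists>X. open X \<and> z \<in> X \<and> X \<subseteq> {z. \<forall>s\<in>K. (z, s) \<notin> W}" by blast
  qed
  moreover have "{z. \<forall>s\<in>K. (z, s) \<notin> W} = - {z. \<exists>s\<in>K. (z, s) \<in> W}" by auto
  ultimately show ?thesis by (simp add: closed_def)
qed

lemma continuous_on_scaleR_dual [continuous_intros]:
  fixes f :: "'b::topological_space \<Rightarrow> 'a::lc_hausdorff_tvs dual"
  assumes "continuous_on S r" "continuous_on S f"
  shows "continuous_on S (\<lambda>s. r s *\<^sub>R f s)"
  by (rule continuous_on_dualI) (simp, intro continuous_intros assms)

definition base :: "'i set \<Rightarrow> ('i \<Rightarrow> 'a::lc_hausdorff_tvs dual) \<Rightarrow> ('i \<Rightarrow> real) \<Rightarrow> ('a dual \<times> real) set" where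
  "base T a b = closure (convex hull ({(a t, b t) | t. t \<in> T} \<union> {(0, 1)}))"

lemma E3_eq: "E3 T a b = {c *\<^sub>R z | c z. 0 \<le> c \<and> z \<in> base T a b}"
  unfolding E3_def base_def cone_hull_expl by auto

lemma hull_subset_base: "convex hull ({(a t, b t) | t. t \<in> T} \<union> {(0, 1)}) \<subseteq> base T a b"
  unfolding base_def by (rule closure_subset)

lemma cone_E3: "cone (E3 T a b)"
  unfolding E3_def by (rule cone_cone_hull)

lemma E3_subset_consequences: "E3 T a b \<subseteq> consequences T a b"
  unfolding E3_def
  by (intro hull_minimal closure_minimal convex_cone_consequences closed_consequences
      generators_subset_consequences)

text \<open>Farkas' lemma is applied to the cone over the hull before closing it, which already
  contains the generators.\<close>

lemma consequences_subset_closure_E3: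
  assumes "feasible T a b \<noteq> {}"
  shows "consequences T a b \<subseteq> closure (E3 T a b)"
proof -
  let ?B = "{(a t, b t) | t. t \<in> T} \<union> {(0, 1)}"
  let ?C = "cone hull (convex hull ?B)"
  have sub: "?C \<subseteq> E3 T a b"
    unfolding E3_def by (intro hull_mono closure_subset)
  have "consequences T a b \<subseteq> closure ?C"
  proof (rule consequences_subset_closure[OF assms])
    show "convex ?C" by (simp add: convex_cone_hull)
    show "cone ?C" by (rule cone_cone_hull)
    show "?B \<subseteq> ?C" by (meson hull_subset order_trans)
    show "?C \<subseteq> consequences T a b" using sub E3_subset_consequences by (rule order_trans)
  qed
  then show ?thesis using closure_mono[OF sub] by blast
qed

section \<open>The value set of the third dual and its inclusion in \<open>E3\<close>\<close>

text \<open>Quantifying over real upper bounds replaces the supremum over \<open>T\<close>, which may be infinite.\<close>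

definition aff_bound ::
    "'i set \<Rightarrow> ('i \<Rightarrow> 'a::lc_hausdorff_tvs dual) \<Rightarrow> ('i \<Rightarrow> real) \<Rightarrow> 'a \<Rightarrow> real \<Rightarrow> bool" where
  "aff_bound T a b x M \<longleftrightarrow> (\<forall>t\<in>T. aff (a t, b t) x \<le> M)"

lemma aff_bound_feasible: "x \<in> feasible T a b \<Longrightarrow> aff_bound T a b x 0"
  by (simp add: feasible_iff_aff aff_bound_def)

text \<open>The set E of the third dual. The multiplier stands on the constraints instead of on
  \<open>M\<close>, so that \<open>l = 0\<close> keeps its meaning: for nonempty \<open>T\<close>
  the bounds are then the \<open>M \<ge> 0\<close>.\<close>

definition LID3_set ::
    "'i set \<Rightarrow> ('i \<Rightarrow> 'a::lc_hausdorff_tvs dual) \<Rightarrow> ('i \<Rightarrow> real) \<Rightarrow> ('a dual \<times> real) set" where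
  "LID3_set T a b = {z. \<exists>l\<ge>0. \<forall>x M. (\<forall>t\<in>T. l * aff (a t, b t) x \<le> M) \<longrightarrow> aff z x \<le> M}"

lemma real_le_SUP_iff:
  fixes h :: "'i \<Rightarrow> real"
  shows "ereal r \<le> (SUP t\<in>T. ereal (h t)) \<longleftrightarrow> (\<forall>M. (\<forall>t\<in>T. h t \<le> M) \<longrightarrow> r \<le> M)"
proof (intro iffI allI impI)
  fix M assume "ereal r \<le> (SUP t\<in>T. ereal (h t))" "\<forall>t\<in>T. h t \<le> M"
  then have "(SUP t\<in>T. ereal (h t)) \<le> ereal M" by (intro SUP_least) auto
  then show "r \<le> M" using \<open>ereal r \<le> _\<close> by (metis ereal_less_eq(3) order_trans)
next
  assume M: "\<forall>M. (\<forall>t\<in>T. h t \<le> M) \<longrightarrow> r \<le> M"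
  show "ereal r \<le> (SUP t\<in>T. ereal (h t))"
  proof (rule ccontr)
    assume "\<not> ?thesis"
    then obtain m where m: "(SUP t\<in>T. ereal (h t)) < ereal m" "m < r"
      using ereal_dense2 by (metis ereal_less(2) less_ereal.simps(1) not_le)
    have "ereal (h t) \<le> ereal m" if "t \<in> T" for t
      using SUP_upper[OF that, of "\<lambda>t. ereal (h t)"] m(1) by (meson less_imp_le order_trans)
    then have "r \<le> m" using M by simp
    then show False using m by simp
  qed
qed

text \<open>The value of \<open>c\<close> at \<open>x\<close> is independent of \<open>t\<close>, so
  it can be moved from the supremum into the bound \<open>M\<close>, which ranges over all
  reals.\<close>

lemma LID3_iff_LID3_set:
  "(\<exists>l\<in>{0..}. ereal r \<le> LID3_obj T a b c l) \<longleftrightarrow> (- c, - r) \<in> LID3_set T a b"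
proof -
  have "ereal r \<le> LID3_obj T a b c l \<longleftrightarrow>
      (\<forall>x M. (\<forall>t\<in>T. l * aff (a t, b t) x \<le> M) \<longrightarrow> aff (- c, - r) x \<le> M)" for l
  proof -
    have "ereal r \<le> (SUP t\<in>T. ereal (dual_apply c x + dual_apply (l *\<^sub>R a t) x - l * b t)) \<longleftrightarrow>
        (\<forall>M. (\<forall>t\<in>T. l * aff (a t, b t) x \<le> M) \<longrightarrow> aff (- c, - r) x \<le> M)" for x
      unfolding real_le_SUP_iff
    proof (intro iffI allI impI)
      fix M
      assume *: "\<forall>M. (\<forall>t\<in>T. dual_apply c x + dual_apply (l *\<^sub>R a t) x - l * b t \<le> M) \<longrightarrow> r \<le> M"
        and "\<forall>t\<in>T. l * aff (a t, b t) x \<le> M"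
      then have "\<forall>t\<in>T. dual_apply c x + dual_apply (l *\<^sub>R a t) x - l * b t \<le> M + dual_apply c x"
        by (auto simp: aff_def algebra_simps)
      with * have "r \<le> M + dual_apply c x" by blast
      then show "aff (- c, - r) x \<le> M" by (simp add: aff_def)
    next
      fix M
      assume *: "\<forall>M. (\<forall>t\<in>T. l * aff (a t, b t) x \<le> M) \<longrightarrow> aff (- c, - r) x \<le> M"
        and "\<forall>t\<in>T. dual_apply c x + dual_apply (l *\<^sub>R a t) x - l * b t \<le> M"
      then have "\<forall>t\<in>T. l * aff (a t, b t) x \<le> M - dual_apply c x"
        by (auto simp: aff_def algebra_simps)
      with * have "aff (- c, - r) x \<le> M - dual_apply c x" by blast
      then show "r \<le> M" by (simp add: aff_def)
    qed
    then show ?thesis unfolding LID3_obj_def le_INF_iff by blast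
  qed
  then show ?thesis unfolding LID3_set_def by auto
qed

lemma LID3_set_scale:
  assumes "z \<in> LID3_set T a b" "0 < c"
  shows "c *\<^sub>R z \<in> LID3_set T a b"
proof -
  obtain l where l: "0 \<le> l" and
    z: "\<And>x M. (\<forall>t\<in>T. l * aff (a t, b t) x \<le> M) \<Longrightarrow> aff z x \<le> M"
    using assms(1) unfolding LID3_set_def by blast
  have "aff (c *\<^sub>R z) x \<le> M" if M: "\<forall>t\<in>T. c * l * aff (a t, b t) x \<le> M" for x M
  proof -
    have "aff z x \<le> M / c" using M \<open>0 < c\<close> by (intro z) (auto simp: field_simps)
    then show ?thesis using \<open>0 < c\<close> by (simp add: field_simps)
  qed
  moreover have "0 \<le> c * l" using l assms(2) by simp
  ultimately show ?thesis unfolding LID3_set_def by blast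
qed

lemma LID3_set_up: "z \<in> LID3_set T a b \<Longrightarrow> 0 \<le> r \<Longrightarrow> z + (0, r) \<in> LID3_set T a b"
  unfolding LID3_set_def by force

lemma zero_in_LID3_set:
  assumes "T \<noteq> {}"
  shows "0 \<in> LID3_set T a b"
proof -
  have "\<forall>x M. (\<forall>t\<in>T. 0 * aff (a t, b t) x \<le> M) \<longrightarrow> aff 0 x \<le> M" using assms by auto
  then show ?thesis unfolding LID3_set_def by blast
qed

lemma bounded_above_dual_eq_0:
  assumes "\<And>x. dual_apply u x \<le> s"
  shows "u = 0"
proof (rule dual_eqI)
  fix x
  show "dual_apply u x = dual_apply 0 x"
  proof (rule ccontr)
    assume "dual_apply u x \<noteq> dual_apply 0 x"
    then have "dual_apply u (((s + 1) / dual_apply u x) *\<^sub>R x) = s + 1"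
      by (simp add: linear_scale[OF linear_dual_apply])
    then show False using assms[of "((s + 1) / dual_apply u x) *\<^sub>R x"] by simp
  qed
qed

text \<open>A point \<open>p + (0, r)\<close> is \<open>1 + r\<close> times a point of the base, and evaluation at the feasible point
  \<open>x0\<close> bounds \<open>r\<close> locally; so only factors from a compact interval matter.\<close>

lemma closure_upward_hull_subset_E3:
  fixes a :: "'i \<Rightarrow> 'a::lc_hausdorff_tvs dual"
  assumes x0: "x0 \<in> feasible T a b"
  shows "closure {p + (0, r) | p r. p \<in> convex hull {(a t, b t) | t. t \<in> T} \<and> 0 \<le> r} \<subseteq> E3 T a b"
    (is "closure ?G \<subseteq> _")
proof
  fix z assume z: "z \<in> closure ?G"
  \<comment> \<open>The term \<open>2 - aff z x0\<close> puts \<open>z\<close> strictly inside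
    \<open>U\<close>. On \<open>U\<close>, \<open>r\<close> is at most \<open>- aff g x0\<close>,
    hence below \<open>N - 1\<close>, so the factor \<open>1 + r\<close> stays in the
    interval.\<close>
  define N where "N = max 1 (2 - aff z x0)"
  \<comment> \<open>The \<open>max\<close> makes the map continuous everywhere and changes nothing
    on \<open>{1..N}\<close>.\<close>
  define H where "H = {y. \<exists>\<mu>\<in>{1..N}. (y, \<mu>) \<in> {q. inverse (max 1 (snd q)) *\<^sub>R fst q \<in> base T a b}}"
  have "continuous_on UNIV (\<lambda>q :: ('a dual \<times> real) \<times> real. inverse (max 1 (snd q)) *\<^sub>R fst q)"
    unfolding scaleR_prod_def by (intro continuous_intros) auto
  then have "closed {q :: ('a dual \<times> real) \<times> real.
      inverse (max 1 (snd q)) *\<^sub>R fst q \<in> base T a b}"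
    using closed_vimage[of "base T a b"] by (simp add: base_def vimage_def)
  then have "closed H" unfolding H_def by (intro closed_compact_projection compact_Icc)
  define U where "U = {y :: 'a dual \<times> real. - aff y x0 < N - 1}"
  have "open U" unfolding U_def by (intro open_Collect_less continuous_intros)
  have "z \<in> U" by (simp add: U_def N_def)
  have "U \<inter> ?G \<subseteq> H"
  proof
    fix g assume g: "g \<in> U \<inter> ?G"
    then obtain p r where p: "p \<in> convex hull {(a t, b t) | t. t \<in> T}" and r: "0 \<le> r"
      and geq: "g = p + (0, r)" by blast
    have "convex hull {(a t, b t) | t. t \<in> T} \<subseteq> consequences T a b"
      using generators_subset_consequences[of a b T]
      by (intro hull_minimal convex_cone_consequences) auto
    then have "aff p x0 \<le> 0" using p x0 consequencesD by blast
    then have "1 + r \<le> N" using g geq by (simp add: U_def)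
    have "(1 / (1 + r)) *\<^sub>R p + (r / (1 + r)) *\<^sub>R (0, 1)
        \<in> convex hull ({(a t, b t) | t. t \<in> T} \<union> {(0, 1)})" (is "_ \<in> convex hull ?B")
    proof (rule convexD[OF convex_convex_hull])
      show "p \<in> convex hull ?B" using p hull_mono[of "{(a t, b t) | t. t \<in> T}" ?B] by blast
      show "(0, 1) \<in> convex hull ?B" by (simp add: hull_inc)
      show "1 / (1 + r) + r / (1 + r) = 1" using r by (simp add: add_divide_distrib[symmetric])
    qed (use r in auto)
    then have "inverse (1 + r) *\<^sub>R g \<in> base T a b"
      using hull_subset_base[of a b T] by (auto simp: geq scaleR_add_right divide_inverse mult.commute)
    then show "g \<in> H" unfolding H_def using r \<open>1 + r \<le> N\<close> by (auto intro!: bexI[of _ "1 + r"] simp: max_def)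
  qed
  then have "closure (U \<inter> ?G) \<subseteq> H" using \<open>closed H\<close> by (rule closure_minimal)
  then have "z \<in> H" using open_Int_closure_subset[OF \<open>open U\<close>] \<open>z \<in> U\<close> z by blast
  then obtain \<mu> where "1 \<le> \<mu>" "inverse \<mu> *\<^sub>R z \<in> base T a b"
    unfolding H_def by (auto simp: max_def split: if_splits)
  then have "\<mu> *\<^sub>R inverse \<mu> *\<^sub>R z \<in> E3 T a b" unfolding E3_eq by fastforce
  then show "z \<in> E3 T a b" using \<open>1 \<le> \<mu>\<close> by simp
qed

text \<open>For \<open>l > 0\<close>, if \<open>z\<close> divided by \<open>l\<close> were outside
  the closed upward hull of the constraint pairs, a separating point \<open>y\<close> would bound
  all constraints by some \<beta> and violate the defining condition of \<open>LID3_set\<close>. For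
  \<open>l = 0\<close> only multiples of \<open>(0, 1)\<close> remain.\<close>

lemma LID3_set_subset_E3:
  fixes a :: "'i \<Rightarrow> 'a::lc_hausdorff_tvs dual"
  assumes "T \<noteq> {}" and x0: "x0 \<in> feasible T a b"
  shows "LID3_set T a b \<subseteq> E3 T a b"
proof
  fix z assume "z \<in> LID3_set T a b"
  then obtain l where l: "0 \<le> l" and
    z: "\<And>x M. (\<forall>t\<in>T. l * aff (a t, b t) x \<le> M) \<Longrightarrow> aff z x \<le> M"
    unfolding LID3_set_def by blast
  show "z \<in> E3 T a b"
  proof (cases "l = 0")
    case True
    then have le: "aff z x \<le> 0" for x using z by simp
    then have "fst z = 0" by (intro bounded_above_dual_eq_0[of _ "snd z"]) (simp add: aff_def)
    moreover from this have "0 \<le> snd z" using le[of 0] by (simp add: aff_def)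
    moreover have "(0, 1) \<in> base T a b" using hull_subset_base[of a b T] by (auto simp: hull_inc)
    ultimately have "snd z *\<^sub>R (0, 1) \<in> E3 T a b" unfolding E3_eq by blast
    then show ?thesis using \<open>fst z = 0\<close> by (metis mult.right_neutral prod.collapse real_scaleR_def scaleR_Pair scaleR_zero_right)
  next
    case False
    with l have "0 < l" by simp
    let ?P = "{(a t, b t) | t. t \<in> T}"
    let ?G = "{p + (0, r) | p r. p \<in> convex hull ?P \<and> 0 \<le> r}"
    have G: "?P \<subseteq> ?G"
    proof -
      have "p = p + (0, 0) \<and> p \<in> convex hull ?P" if "p \<in> ?P" for p
        using that hull_inc[of p ?P] by (simp add: zero_prod_def[symmetric])
      then show ?thesis by blast
    qed
    have conv: "convex ?G"
    proof -
      have "?G = (\<Union>p\<in>convex hull ?P. \<Union>q\<in>{(0, r) | r. 0 \<le> r}. {p + q})" by blast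
      moreover have "convex {(0 :: 'a dual, r :: real) | r. 0 \<le> r}"
        by (auto simp: convex_def)
      ultimately show ?thesis by (simp add: convex_sums)
    qed
    have "(1 / l) *\<^sub>R z \<in> closure ?G"
    proof (rule ccontr)
      assume notin: "(1 / l) *\<^sub>R z \<notin> closure ?G"
      have ne: "?G \<noteq> {}" using G \<open>T \<noteq> {}\<close> by blast
      have up: "s + (0, r) \<in> ?G" if "s \<in> ?G" "0 \<le> r" for s r
      proof -
        obtain p q where "s = p + (0, q)" "p \<in> convex hull ?P" "0 \<le> q" using \<open>s \<in> ?G\<close> by blast
        moreover from this have "s + (0, r) = p + (0, q + r)" by (simp add: add.assoc)
        moreover have "0 \<le> q + r" using \<open>0 \<le> q\<close> \<open>0 \<le> r\<close> by simp
        ultimately show ?thesis by (intro CollectI exI[of _ p] exI[of _ "q + r"] conjI)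
      qed
      have bound: "aff s x0 \<le> 0" if "s \<in> ?G" for s
      proof -
        have "s \<in> closure ?G" using that closure_subset by (rule set_rev_mp)
        then have "s \<in> consequences T a b"
          using closure_upward_hull_subset_E3[OF x0] E3_subset_consequences by (meson subsetD)
        then show ?thesis using x0 by (rule consequencesD)
      qed
      obtain \<beta> y where \<beta>: "\<beta> < aff ((1 / l) *\<^sub>R z) y" "\<forall>s\<in>?G. aff s y \<le> \<beta>"
        by (rule upward_closed_separation[OF conv ne notin up bound])
      have "aff (a t, b t) y \<le> \<beta>" if "t \<in> T" for t
        using \<beta>(2) G that by blast
      then have "\<forall>t\<in>T. l * aff (a t, b t) y \<le> l * \<beta>"
        using \<open>0 < l\<close> by simp
      from z[OF this] show False using \<beta>(1) \<open>0 < l\<close> by (simp add: field_simps)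
    qed
    then have "(1 / l) *\<^sub>R z \<in> E3 T a b" using closure_upward_hull_subset_E3[OF x0] by blast
    from mem_cone[OF cone_E3 this l] show ?thesis using \<open>0 < l\<close> by simp
  qed
qed

section \<open>Vertical weights and the converse inclusion\<close>

text \<open>The parameter \<open>s\<close> is the weight of the vertical direction \<open>(0, 1)\<close>; it survives passing to
  the closure because it ranges over a compact interval.\<close>

lemma base_weight:
  fixes a :: "'i \<Rightarrow> 'a::lc_hausdorff_tvs dual"
  assumes "z \<in> base T a b"
  obtains s where "0 \<le> s" "s \<le> 1" "\<And>x M. aff_bound T a b x M \<Longrightarrow> aff z x \<le> (1 - s) * M - s"
proof -
  \<comment> \<open>The right-hand side averages the bound \<open>M\<close> and the value -1 of
    \<open>aff (0, 1) x\<close> with weights \<open>1 - s\<close> and \<open>s\<close>.\<close>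
  define W :: "(('a dual \<times> real) \<times> real) set" where
    "W = {q. \<forall>x M. aff_bound T a b x M \<longrightarrow> aff (fst q) x \<le> (1 - snd q) * M - snd q}"
  define V where "V = {z. \<exists>s\<in>{0..1}. (z, s) \<in> W}"
  have "closed W"
    unfolding W_def
    by (intro closed_Collect_all closed_Collect_imp open_Collect_const closed_Collect_le
        continuous_intros)
  then have "closed V" unfolding V_def by (intro closed_compact_projection compact_Icc)
  \<comment> \<open>The inequality is affine in point and weight jointly, so weights average along
    with the points.\<close>
  have "convex V"
  proof (rule convexI)
    fix y z and u v :: real
    assume "y \<in> V" "z \<in> V" and uv: "0 \<le> u" "0 \<le> v" "u + v = 1"
    then obtain s s' where s: "0 \<le> s" "s \<le> 1" "(y, s) \<in> W" and s': "0 \<le> s'" "s' \<le> 1" "(z, s') \<in> W"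
      by (auto simp: V_def)
    let ?s = "u * s + v * s'"
    have "0 \<le> ?s" using uv s s' by simp
    moreover have "?s \<le> 1" using convex_bound_le[of s 1 s' u v] uv s s' by simp
    moreover have "aff (u *\<^sub>R y + v *\<^sub>R z) x \<le> (1 - ?s) * M - ?s" if "aff_bound T a b x M" for x M
    proof -
      have "aff y x \<le> (1 - s) * M - s" "aff z x \<le> (1 - s') * M - s'"
        using s(3) s'(3) that by (auto simp: W_def)
      then have "aff (u *\<^sub>R y + v *\<^sub>R z) x \<le> u * ((1 - s) * M - s) + v * ((1 - s') * M - s')"
        using uv by (simp add: add_mono mult_left_mono)
      also have "\<dots> = (u + v - ?s) * M - ?s" by (simp add: algebra_simps)
      finally show ?thesis using uv by simp
    qed
    ultimately show "u *\<^sub>R y + v *\<^sub>R z \<in> V"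
      unfolding V_def W_def by (auto intro!: bexI[of _ ?s])
  qed
  have "(a t, b t) \<in> V" if "t \<in> T" for t
    unfolding V_def W_def using that by (auto simp: aff_bound_def intro!: bexI[of _ 0])
  moreover have "(0, 1) \<in> V"
    unfolding V_def W_def by (auto intro!: bexI[of _ 1])
  ultimately have "{(a t, b t) | t. t \<in> T} \<union> {(0, 1)} \<subseteq> V" by blast
  then have "base T a b \<subseteq> V"
    unfolding base_def using \<open>closed V\<close> \<open>convex V\<close> by (intro closure_minimal hull_minimal)
  then obtain s where "0 \<le> s" "s \<le> 1" "(z, s) \<in> W" using assms unfolding V_def by fastforce
  then show ?thesis using that[of s] by (auto simp: W_def)
qed

text \<open>A weight \<open>s < 1\<close> leaves \<open>1 - s\<close> as a multiplier. Full weight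
  \<open>s = 1\<close> makes the bound independent of \<open>M\<close>, which describes the limits
  without a usable multiplier.\<close>

lemma base_cases:
  assumes "z \<in> base T a b"
  shows "z \<in> LID3_set T a b \<or> (\<forall>x M. aff_bound T a b x M \<longrightarrow> aff z x \<le> - 1)"
proof -
  obtain s where s: "0 \<le> s" "s \<le> 1" and
    z: "\<And>x M. aff_bound T a b x M \<Longrightarrow> aff z x \<le> (1 - s) * M - s"
    using base_weight[OF assms] by metis
  show ?thesis
  proof (cases "s = 1")
    case True
    then show ?thesis using z by fastforce
  next
    case False
    then have pos: "0 < 1 - s" using s by simp
    have "aff z x \<le> M" if M: "\<forall>t\<in>T. (1 - s) * aff (a t, b t) x \<le> M" for x M
    proof -
      have "aff_bound T a b x (M / (1 - s))"
        using M pos by (auto simp: aff_bound_def pos_le_divide_eq mult.commute)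
      from z[OF this] show ?thesis using pos s by simp
    qed
    then have "z \<in> LID3_set T a b" unfolding LID3_set_def using pos by (auto intro!: exI[of _ "1 - s"])
    then show ?thesis ..
  qed
qed

text \<open>A point \<open>z\<close> of the base with full vertical weight is pushed down vertically as far as it
  stays nonpositive on the points \<open>x\<close> where \<open>\<langle>a\<^sub>t, x\<rangle> - b\<^sub>t\<close> is bounded above. The lowest such point is
  still a consequence, hence a multiple of an element of the base, which can no longer have full
  vertical weight.\<close>

lemma closed_E3_imp_consequences_subset:
  fixes a :: "'i \<Rightarrow> 'a::lc_hausdorff_tvs dual"
  assumes "T \<noteq> {}" and x0: "x0 \<in> feasible T a b" and sub: "consequences T a b \<subseteq> E3 T a b"
  shows "E3 T a b \<subseteq> LID3_set T a b"
proof
  fix k assume "k \<in> E3 T a b"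
  then obtain c z where c: "0 \<le> c" and z: "z \<in> base T a b" and k: "k = c *\<^sub>R z"
    unfolding E3_eq by blast
  define dom where "dom = {x. \<exists>M. aff_bound T a b x M}"
  have x0_dom: "x0 \<in> dom" using aff_bound_feasible[OF x0] by (auto simp: dom_def)
  note zero = zero_in_LID3_set[OF \<open>T \<noteq> {}\<close>, of a b]
  show "k \<in> LID3_set T a b"
  proof (cases "c = 0 \<or> z \<in> LID3_set T a b")
    case True
    then show ?thesis using zero LID3_set_scale c k by (metis less_eq_real_def scaleR_zero_left)
  next
    case False
    then have "0 < c" using c by simp
    have z_le: "aff z x \<le> - 1" if "x \<in> dom" for x
      using base_cases[OF z] False that by (auto simp: dom_def)
    \<comment> \<open>With this shift, \<open>aff q\<close> has supremum exactly 0 on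
      \<open>dom\<close>.\<close>
    define \<sigma> where "\<sigma> = (SUP x\<in>dom. aff z x)"
    have bdd: "bdd_above (aff z ` dom)" using z_le by (auto intro!: bdd_aboveI)
    have \<sigma>: "aff z x \<le> \<sigma>" if "x \<in> dom" for x
      unfolding \<sigma>_def using bdd that by (intro cSUP_upper)
    have \<sigma>_least: "\<sigma> \<le> m" if "\<And>x. x \<in> dom \<Longrightarrow> aff z x \<le> m" for m
      unfolding \<sigma>_def using x0_dom that by (intro cSUP_least) auto
    define q where "q = z + (0, \<sigma>)"
    have aff_q: "aff q x = aff z x - \<sigma>" for x by (simp add: q_def)
    have "q \<in> consequences T a b"
      using \<sigma> aff_bound_feasible[of _ T a b] by (fastforce simp: consequences_def aff_q dom_def)
    then have "q \<in> E3 T a b" using sub by blast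
    then obtain m z' where m: "0 \<le> m" and z': "z' \<in> base T a b" and q: "q = m *\<^sub>R z'"
      unfolding E3_eq by blast
    have "q \<in> LID3_set T a b"
    proof (cases "m = 0 \<or> z' \<in> LID3_set T a b")
      case True
      then show ?thesis using zero LID3_set_scale m q by (metis less_eq_real_def scaleR_zero_left)
    next
      case False
      then have "0 < m" using m by simp
      have "aff z' x \<le> - 1" if "x \<in> dom" for x
        using base_cases[OF z'] False that by (auto simp: dom_def)
      \<comment> \<open>Full weight of \<open>z'\<close> would keep \<open>aff q\<close> at most
        \<open>- m\<close> on \<open>dom\<close>, against its supremum 0.\<close>
      then have "aff z x - \<sigma> \<le> - m" if "x \<in> dom" for x
        using that mult_left_mono[of "aff z' x" "- 1" m] m aff_q[of x] by (simp add: q)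
      then have "\<sigma> \<le> \<sigma> - m" by (intro \<sigma>_least) force
      then show ?thesis using \<open>0 < m\<close> by simp
    qed
    \<comment> \<open>Since \<sigma> is at most -1, returning from \<open>q\<close> to
      \<open>z\<close> is an upward move, which \<open>LID3_set\<close> allows.\<close>
    moreover have "0 \<le> - \<sigma>" using \<sigma>_least[of "- 1"] z_le by force
    ultimately have "q + (0, - \<sigma>) \<in> LID3_set T a b" by (rule LID3_set_up)
    then have "z \<in> LID3_set T a b" by (simp add: q_def add.assoc zero_prod_def[symmetric])
    then show ?thesis using LID3_set_scale \<open>0 < c\<close> k by blast
  qed
qed

text \<open>\<open>E3\<close> is squeezed between \<open>LID3_set\<close> and
  \<open>consequences\<close>. Closedness makes the upper inclusion an equality by Farkas' lemma,
  and that equality forces the lower one.\<close>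

lemma E3_closed_iff:
  assumes "T \<noteq> {}" "feasible T a b \<noteq> {}"
  shows "closed (E3 T a b) \<longleftrightarrow> LID3_set T a b = consequences T a b"
proof -
  obtain x0 where x0: "x0 \<in> feasible T a b" using assms by blast
  note sub = LID3_set_subset_E3[OF assms(1) x0] E3_subset_consequences[of T a b]
  show ?thesis
  proof
    assume "closed (E3 T a b)"
    then have *: "consequences T a b \<subseteq> E3 T a b"
      using consequences_subset_closure_E3[OF assms(2)] by (simp add: closure_closed)
    then show "LID3_set T a b = consequences T a b"
      using closed_E3_imp_consequences_subset[OF assms(1) x0 *] sub by blast
  next
    assume "LID3_set T a b = consequences T a b"
    then have "E3 T a b = consequences T a b" using sub by blast
    then show "closed (E3 T a b)" by (simp add: closed_consequences)
  qed
qed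

theorem corollary6p5:
  fixes T :: "'i set" and a :: "'i \<Rightarrow> 'a::lc_hausdorff_tvs dual" and b :: "'i \<Rightarrow> real"
  assumes "T \<noteq> {}" and "feasible T a b \<noteq> {}"
  shows "(closed (E1 T a b) \<and> convex (E1 T a b) \<longleftrightarrow>
            (\<forall>c. inf_eq_max (inf_LIP T a b c) (LID1_feasible T a c) (LID1_obj b))) \<and>
         (closed (E2 T a b) \<longleftrightarrow>
            (\<forall>c. inf_eq_max (inf_LIP T a b c) (LID2_feasible T a c) (LID2_obj T b))) \<and>
         (closed (E3 T a b) \<longleftrightarrow>
            (\<forall>c. inf_eq_max (inf_LIP T a b c) {0..} (LID3_obj T a b c)))"
  unfolding E1_closed_convex_iff[OF assms] E2_closed_iff[OF assms(2)] E3_closed_iff[OF assms]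
    stable_duality_iff[where D = "LID1_feasible T a" and g = "\<lambda>_. LID1_obj b", OF assms(2) LID1_iff_E1]
    stable_duality_iff[where D = "LID2_feasible T a" and g = "\<lambda>_. LID2_obj T b", OF assms(2) LID2_iff_E2]
    stable_duality_iff[where D = "\<lambda>_. {0..}" and g = "LID3_obj T a b", OF assms(2) LID3_iff_LID3_set]
  by blast

end
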